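(* Let $\mathcal{H}$ be a real Hilbert space, let $f:\mathcal{H}\to\mathbb{R}$ be continuous and convex, let $S\subseteq\mathcal{H}$ be a compact and convex set, and let $\{x_k\}_{k\in\mathbb{N}}$ be a sequence generated by projected subgradient ascent for $f$ over $S$ with real step sizes $\{\eta_k\}_{k\in\mathbb{N}}$ satisfying $\limsup_{k\to\infty}\eta_k<\infty$ and $\liminf_{k\to\infty}\eta_k>0$. Then every accumulation point of $\{x_k\}_{k\in\mathbb{N}}$ is a first-order stationary point for the maximization of $f$ over $S$.
   Context: Compactness and accumulation points (limits of subsequences) are with respect to the norm topology of $\mathcal{H}$. For $x\in\mathcal{H}$, $P_S(x)$ denotes the orthogonal projection of $x$ onto the nonempty closed convex set $S$, i.e. the unique point of $S$ closest to $x$. The subdifferential is $\partial f(x)=\{g\in\mathcal{H}: f(y)\ge f(x)+\langle g,y-x\rangle\ \text{for all } y\in\mathcal{H}\}$; its elements are called subgradients of $f$ at $x$. Projected subgradient ascent (PGA): given a convex function $f:\mathcal{H}\to\mathbb{R}$, a nonempty closed convex set $S\subseteq\mathcal{H}$ and step sizes $\{\eta_k\}_{k\in\mathbb{N}}$, a sequence $\{x_k\}_{k\in\mathbb{N}}$ of points of $S$ (so $x_0\in S$) is generated by PGA if for every $k$, $x_{k+1}=P_S(x_k+\eta_k g_k)$, where $g_k\in\partial f(x_k)$ is any subgradient of $f$ at $x_k$. First-order stationarity: a point $x\in S$ is a first-order stationary point for the maximization of $f$ over $S$ if there exists a subgradient $g\in\partial f(x)$ such that $\langle g,z-x\rangle\le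 0$ for all $z\in S$. *)

theory Defs
  imports "HOL-Analysis.Analysis"
begin

(* Real Hilbert spaces are the types of sort {real_inner, complete_space}. *)

definition subdifferential :: "('a::real_inner \<Rightarrow> real) \<Rightarrow> 'a \<Rightarrow> 'a set" where
  "subdifferential f x = {g. \<forall>y. f y \<ge> f x + g \<bullet> (y - x)}"

(* The library's closest_point needs sort heine_borel, which excludes infinite-dimensional
   spaces.  The description is well-defined for S nonempty, closed and convex. *)
definition proj :: "'a::{real_inner,complete_space} set \<Rightarrow> 'a \<Rightarrow> 'a" where
  "proj S x = (THE p. p \<in> S \<and> (\<forall>y\<in>S. dist x p \<le> dist x y))"

definition projected_subgradient_ascent ::
  "('a::{real_inner,complete_space} \<Rightarrow> real) \<Rightarrow> 'a set \<Rightarrow> (nat \<Rightarrow> real) \<Rightarrow> (nat \<Rightarrow> 'a) \<Rightarrow> bool" where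
  "projected_subgradient_ascent f S \<eta> x \<longleftrightarrow>
     (\<forall>k. x k \<in> S) \<and>
     (\<forall>k. \<exists>g \<in> subdifferential f (x k). x (Suc k) = proj S (x k + \<eta> k *\<^sub>R g))"

definition first_order_stationary :: "('a::real_inner \<Rightarrow> real) \<Rightarrow> 'a set \<Rightarrow> 'a \<Rightarrow> bool" where
  "first_order_stationary f S x \<longleftrightarrow>
     x \<in> S \<and> (\<exists>g \<in> subdifferential f x. \<forall>z\<in>S. g \<bullet> (z - x) \<le> 0)"

(* Limits of subsequences; this is not the library's islimpt applied to range x, since a
   value attained infinitely often also counts. *)
definition accumulation_point :: "(nat \<Rightarrow> 'a::topological_space) \<Rightarrow> 'a \<Rightarrow> bool" where
  "accumulation_point x a \<longleftrightarrow> (\<exists>r. strict_mono r \<and> (x \<circ> r) \<longlonglongrightarrow> a)"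

end

theory Submission
  imports Defs
begin

text \<open>
  The variational inequality for the projection gives the ascent estimate
  \<open>f (x (k+1)) - f (x k) \<ge> (norm (x (k+1) - x k))\<^sup>2 / \<eta> k\<close>, so the increments of \<open>x\<close>
  tend to \<open>0\<close> because \<open>f\<close> is bounded on \<open>S\<close>, and hence the subgradients along a convergent
  subsequence are stationary up to an error tending to \<open>0\<close>. These subgradients are bounded
  but need not have a norm-convergent subsequence. Instead of a weak limit, take a point in the
  intersection of the nested closed convex bounded sets of approximately stationary approximate
  subgradients at \<open>a\<close>; the intersection is nonempty because almost norm-minimal elements of
  these sets form a Cauchy sequence.
\<close>

text \<open>Substitute for weak compactness. The least norms \<open>d n\<close> increase and stay
  bounded, so they converge; the parallelogram law then makes nearly norm-minimal points
  \<open>p n\<close> Cauchy, and closedness puts their limit in every \<open>C n\<close>.\<close>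

lemma Int_decseq_closed_convex_bounded_nonempty:
  fixes C :: "nat \<Rightarrow> 'a::{real_inner,complete_space} set"
  assumes closed: "\<And>n. closed (C n)" and convex: "\<And>n. convex (C n)"
    and ne: "\<And>n. C n \<noteq> {}" and dec: "decseq C" and bdd: "bounded (C 0)"
  shows "(\<Inter>n. C n) \<noteq> {}"
proof -
  define d where "d n = Inf (norm ` C n)" for n
  have d_le: "d n \<le> norm h" if "h \<in> C n" for n h
    unfolding d_def using that by (intro cInf_lower bdd_belowI[of _ 0]) auto
  have d_nonneg: "0 \<le> d n" for n
    unfolding d_def using ne by (intro cInf_greatest) auto
  obtain M where M: "\<And>h. h \<in> C 0 \<Longrightarrow> norm h \<le> M"
    using bdd by (auto simp: bounded_iff)
  have sub: "C m \<subseteq> C n" if "n \<le> m" for n m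
    using dec that by (auto simp: decseq_def)
  have "d n \<le> d m" if "n \<le> m" for n m
    unfolding d_def[of m] using ne[of m] sub[OF that] d_le by (intro cInf_greatest) auto
  then have "incseq d"
    by (auto simp: incseq_def)
  moreover have "d n \<le> M" for n
    using ne[of n] d_le M sub[of 0 n] by (metis ex_in_conv le0 order_trans subsetD)
  ultimately obtain l where l: "d \<longlonglongrightarrow> l" and dl: "\<And>n. d n \<le> l"
    by (metis incseq_convergent)
  have "\<exists>h\<in>C n. norm h < d n + 1 / real (Suc n)" for n
  proof -
    have "\<exists>t\<in>norm ` C n. t < d n + 1 / real (Suc n)"
      using ne[of n] unfolding d_def by (intro cInf_lessD) auto
    then show ?thesis
      by blast
  qed
  then obtain p where p: "\<And>n. p n \<in> C n" and pn: "\<And>n. norm (p n) < d n + 1 / real (Suc n)"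
    by metis
  \<comment> \<open>Parallelogram bound: for \<open>n \<le> m\<close> both \<open>p n\<close> and
    \<open>p m\<close> have norm at most \<open>l + 1 / real (Suc n)\<close>, while their midpoint
    lies in \<open>C n\<close> and so has norm at least \<open>d n\<close>. Since \<open>d\<close>
    tends to \<open>l\<close>, \<open>e\<close> tends to 0.\<close>
  define e where "e n = 4 * ((l + 1 / real (Suc n))\<^sup>2 - (d n)\<^sup>2)" for n
  have dist_p: "(dist (p n) (p m))\<^sup>2 \<le> e n" if "n \<le> m" for n m
  proof -
    have "midpoint (p n) (p m) \<in> C n"
      using convexD[OF convex p[of n], of "p m" "1/2" "1/2"] p[of m] sub[OF that]
      by (auto simp: midpoint_def scaleR_add_right)
    then have "d n \<le> norm (midpoint (p n) (p m))"
      by (rule d_le)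
    then have "(d n)\<^sup>2 \<le> (norm (midpoint (p n) (p m)))\<^sup>2"
      using d_nonneg by (intro power_mono)
    also have "\<dots> = (norm (p n + p m))\<^sup>2 / 4"
      by (simp add: midpoint_def power2_eq_square)
    finally have mid: "4 * (d n)\<^sup>2 \<le> (norm (p n + p m))\<^sup>2"
      by simp
    have "1 / real (Suc m) \<le> 1 / real (Suc n)"
      using that by (simp add: frac_le)
    then have "norm (p m) \<le> l + 1 / real (Suc n)" "norm (p n) \<le> l + 1 / real (Suc n)"
      using pn[of m] pn[of n] dl[of m] dl[of n] by linarith+
    then have "(norm (p m))\<^sup>2 \<le> (l + 1 / real (Suc n))\<^sup>2"
              "(norm (p n))\<^sup>2 \<le> (l + 1 / real (Suc n))\<^sup>2"
      by (auto intro!: power_mono)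
    moreover have "(norm (p n + p m))\<^sup>2 + (norm (p n - p m))\<^sup>2 = 2 * (norm (p n))\<^sup>2 + 2 * (norm (p m))\<^sup>2"
      by (simp add: power2_norm_eq_inner algebra_simps inner_commute)
    ultimately show ?thesis
      using mid by (simp add: e_def dist_norm)
  qed
  have "(\<lambda>n. 1 / real (Suc n)) \<longlonglongrightarrow> 0"
    using LIMSEQ_inverse_real_of_nat by (simp add: inverse_eq_divide)
  then have "e \<longlonglongrightarrow> 4 * ((l + 0)\<^sup>2 - l\<^sup>2)"
    unfolding e_def by (intro tendsto_intros l)
  then have e0: "e \<longlonglongrightarrow> 0"
    by simp
  have "Cauchy p"
    unfolding Cauchy_altdef
  proof (intro allI impI)
    fix r :: real assume "0 < r"
    then have "eventually (\<lambda>n. e n < r\<^sup>2) sequentially"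
      using e0 by (intro order_tendstoD(2)[OF e0]) auto
    then obtain N where N: "\<And>n. n \<ge> N \<Longrightarrow> e n < r\<^sup>2"
      by (auto simp: eventually_sequentially)
    have "dist (p m) (p n) < r" if "N \<le> m" "m < n" for m n
      using dist_p[of m n] N[of m] that \<open>0 < r\<close>
      by (intro power_less_imp_less_base[of _ 2 r]) linarith+
    then show "\<exists>M. \<forall>m\<ge>M. \<forall>n>m. dist (p m) (p n) < r"
      by blast
  qed
  then obtain q where q: "p \<longlonglongrightarrow> q"
    by (auto simp: Cauchy_convergent_iff convergent_def)
  have "q \<in> C n" for n
  proof (rule Lim_in_closed_set[OF closed _ _ q])
    show "eventually (\<lambda>m. p m \<in> C n) sequentially"
      using p sub unfolding eventually_sequentially by blast
  qed simp
  then show ?thesis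
    by blast
qed

text \<open>Compactness makes the distance to \<open>x\<close> attain its minimum on
  \<open>S\<close> and convexity makes the minimiser unique, so the description in
  \<open>proj\<close> denotes it and the variational inequality for nearest points applies.\<close>

lemma proj_dot:
  fixes S :: "'a::{real_inner,complete_space} set"
  assumes "compact S" "convex S" "z \<in> S"
  shows "(x - proj S x) \<bullet> (z - proj S x) \<le> 0"
proof -
  have cl: "closed S" using assms(1) by (rule compact_imp_closed)
  have "\<exists>p\<in>S. \<forall>y\<in>S. dist x p \<le> dist x y"
    using assms by (intro continuous_attains_inf continuous_intros) auto
  then have "\<exists>!p. p \<in> S \<and> (\<forall>y\<in>S. dist x p \<le> dist x y)"
    using any_closest_point_unique[OF assms(2) cl] by blast
  then have "proj S x \<in> S \<and> (\<forall>y\<in>S. dist x (proj S x) \<le> dist x y)"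
    unfolding proj_def by (rule theI')
  then show ?thesis
    using any_closest_point_dot[OF assms(2) cl] assms(3) by blast
qed

text \<open>Testing the subgradient inequality at distance \<open>d\<close> from \<open>x\<close> in
  the direction of \<open>g\<close> yields an increase of at least \<open>d * norm g\<close>. For
  \<open>g = 0\<close>, testing the bound at \<open>x\<close> itself gives
  \<open>0 \<le> B\<close>.\<close>

lemma subdifferential_norm_le:
  assumes "g \<in> subdifferential f x" and "0 < d" and "\<And>y. y \<in> cball x d \<Longrightarrow> f y \<le> f x + B"
  shows "norm g \<le> B / d"
proof (cases "g = 0")
  case True
  then show ?thesis
    using assms(2) assms(3)[of x] by simp
next
  case False
  define y where "y = x + (d / norm g) *\<^sub>R g"
  have "y \<in> cball x d"
    using False assms(2) by (simp add: y_def dist_norm)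
  then have "f x + g \<bullet> (y - x) \<le> f x + B"
    using assms(1) assms(3)[of y] unfolding subdifferential_def by (blast intro: order_trans)
  moreover have "g \<bullet> (y - x) = d * norm g"
    using False by (simp add: y_def dot_square_norm power2_eq_square)
  ultimately show ?thesis
    using assms(2) by (simp add: pos_le_divide_eq mult.commute)
qed

lemma subgradients_bounded_at_limit:
  fixes f :: "'a::real_inner \<Rightarrow> real"
  assumes "isCont f a" and "y \<longlonglongrightarrow> a" and "\<And>j. h j \<in> subdifferential f (y j)"
  obtains M where "0 \<le> M" and "\<forall>\<^sub>F j in sequentially. norm (h j) \<le> M"
proof -
  obtain d where d: "0 < d" and fd: "\<And>z. dist z a < d \<Longrightarrow> dist (f z) (f a) < 1"
    using assms(1) unfolding continuous_at_eps_delta by (metis zero_less_one)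
  \<comment> \<open>The half-radius ball around \<open>y j\<close> stays within distance
    \<open>d\<close> of \<open>a\<close>, where \<open>f\<close> differs from \<open>f a\<close> by
    less than 1; hence \<open>f\<close> rises by at most 2 on that ball.\<close>
  have "norm (h j) \<le> 2 / (d / 2)" if "dist (y j) a < d / 2" for j
  proof (rule subdifferential_norm_le[OF assms(3)])
    fix z assume "z \<in> cball (y j) (d / 2)"
    then have "dist z a < d"
      using that dist_triangle[of z a "y j"] by (simp add: dist_commute)
    then show "f z \<le> f (y j) + 2"
      using fd[of z] fd[of "y j"] that d by (simp add: dist_real_def)
  qed (use d in simp)
  moreover have "\<forall>\<^sub>F j in sequentially. dist (y j) a < d / 2"
    using tendstoD[OF assms(2), of "d / 2"] d by simp
  ultimately have "\<forall>\<^sub>F j in sequentially. norm (h j) \<le> 2 / (d / 2)"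
    by (simp add: eventually_mono)
  then show ?thesis
    using that[of "2 / (d / 2)"] d by simp
qed

text \<open>For fixed \<open>\<epsilon>\<close> the admissible \<open>h\<close> form an intersection
  of a ball with closed half-spaces, shrinking as \<open>\<epsilon>\<close> decreases. The bound
  \<open>M\<close>, uniform in \<open>\<epsilon>\<close>, provides the boundedness needed for a
  common point, which satisfies all inequalities with error 0.\<close>

lemma first_order_stationaryI_approximate:
  fixes f :: "'a::{real_inner,complete_space} \<Rightarrow> real"
  assumes "a \<in> S"
    and approx: "\<And>\<epsilon>. 0 < \<epsilon> \<Longrightarrow> \<exists>h. norm h \<le> M \<and> (\<forall>y. h \<bullet> (y - a) \<le> f y - f a + \<epsilon>) \<and>
                                      (\<forall>z\<in>S. h \<bullet> (z - a) \<le> \<epsilon>)"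
  shows "first_order_stationary f S a"
proof -
  define \<epsilon> where "\<epsilon> n = 1 / real (Suc n)" for n
  define C where "C n = cball 0 M \<inter> (\<Inter>y. {h. (y - a) \<bullet> h \<le> f y - f a + \<epsilon> n}) \<inter>
                        (\<Inter>z\<in>S. {h. (z - a) \<bullet> h \<le> \<epsilon> n})" for n
  have \<epsilon>0: "\<epsilon> \<longlonglongrightarrow> 0"
    using LIMSEQ_inverse_real_of_nat by (simp add: \<epsilon>_def[abs_def] inverse_eq_divide)
  have "(\<Inter>n. C n) \<noteq> {}"
  proof (rule Int_decseq_closed_convex_bounded_nonempty)
    show "closed (C n)" for n
      unfolding C_def by (intro closed_Int closed_INT ballI closed_cball closed_halfspace_le)
    show "convex (C n)" for n
      unfolding C_def by (intro convex_Int convex_INT convex_cball convex_halfspace_le)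
    show "C n \<noteq> {}" for n
    proof -
      have "0 < \<epsilon> n"
        by (simp add: \<epsilon>_def)
      from approx[OF this] show ?thesis
        by (auto simp: C_def inner_commute)
    qed
    have "\<epsilon> m \<le> \<epsilon> n" if "n \<le> m" for n m
      using that by (simp add: \<epsilon>_def frac_le)
    then show "decseq C"
      unfolding decseq_def C_def by (fastforce intro: order_trans)
    show "bounded (C 0)"
      by (rule bounded_subset[OF bounded_cball[of 0 M]]) (auto simp: C_def)
  qed
  then obtain h where h: "\<And>n. h \<in> C n"
    by blast
  have lim_le: "s \<le> t" if "\<And>n. s \<le> t + \<epsilon> n" for s t
    using LIMSEQ_le_const[OF tendsto_add[OF tendsto_const \<epsilon>0], of s t] that by simp
  have "(y - a) \<bullet> h \<le> f y - f a" for y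
    by (rule lim_le) (use h in \<open>auto simp: C_def\<close>)
  then have "h \<in> subdifferential f a"
    by (simp add: subdifferential_def inner_commute le_diff_eq add.commute)
  moreover have "(z - a) \<bullet> h \<le> 0" if "z \<in> S" for z
    by (rule lim_le) (use h that in \<open>auto simp: C_def\<close>)
  ultimately show ?thesis
    using assms(1) by (auto simp: first_order_stationary_def inner_commute)
qed

text \<open>The variational inequality tested at the previous iterate \<open>x k\<close> bounds the
  squared increment by \<open>B\<close> times the gain in \<open>f\<close>; the gains tend to 0
  because the values of \<open>f\<close> converge.\<close>

lemma projected_ascent_increments_tendsto_0:
  fixes f :: "'a::{real_inner,complete_space} \<Rightarrow> real"
  assumes "continuous_on S f" "compact S" "convex S"
    and xS: "\<And>k. x k \<in> S" and g: "\<And>k. g k \<in> subdifferential f (x k)"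
    and step: "\<And>k. x (Suc k) = proj S (x k + \<eta> k *\<^sub>R g k)"
    and \<eta>: "\<And>k. N \<le> k \<Longrightarrow> 0 < \<eta> k \<and> \<eta> k \<le> B"
  shows "(\<lambda>k. x (Suc k) - x k) \<longlonglongrightarrow> 0"
proof -
  have "(x k + \<eta> k *\<^sub>R g k - x (Suc k)) \<bullet> (x k - x (Suc k)) \<le> 0" for k
    using proj_dot[OF assms(2,3) xS] step by metis
  then have vi: "(norm (x (Suc k) - x k))\<^sup>2 \<le> \<eta> k * (g k \<bullet> (x (Suc k) - x k))" for k
    by (simp add: power2_norm_eq_inner algebra_simps inner_commute)
  have sg: "g k \<bullet> (x (Suc k) - x k) \<le> f (x (Suc k)) - f (x k)" for k
    using g[of k] by (simp add: subdifferential_def algebra_simps)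
  have sq: "(norm (x (Suc k) - x k))\<^sup>2 \<le> B * (f (x (Suc k)) - f (x k))"
    and mono: "f (x k) \<le> f (x (Suc k))" if "N \<le> k" for k
  proof -
    \<comment> \<open>The sign of the inner product must be known before \<open>\<eta> k\<close> can
      be replaced by its upper bound \<open>B\<close>.\<close>
    have "0 \<le> \<eta> k * (g k \<bullet> (x (Suc k) - x k))"
      using vi[of k] zero_le_power2 order_trans by blast
    then have nn: "0 \<le> g k \<bullet> (x (Suc k) - x k)"
      using \<eta>[OF that] by (simp add: zero_le_mult_iff)
    then show "f (x k) \<le> f (x (Suc k))"
      using sg[of k] by linarith
    have "\<eta> k * (g k \<bullet> (x (Suc k) - x k)) \<le> B * (f (x (Suc k)) - f (x k))"
      using \<eta>[OF that] nn sg[of k] by (intro mult_mono) auto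
    with vi[of k] show "(norm (x (Suc k) - x k))\<^sup>2 \<le> B * (f (x (Suc k)) - f (x k))"
      by linarith
  qed
  obtain K where K: "\<And>y. y \<in> S \<Longrightarrow> f y \<le> K"
    using continuous_attains_sup[OF assms(2) _ assms(1)] xS by blast
  \<comment> \<open>Ascent is guaranteed only from index \<open>N\<close> on, hence the
    shift.\<close>
  have "incseq (\<lambda>k. f (x (k + N)))"
    by (rule incseq_SucI) (simp add: mono)
  then obtain l where "(\<lambda>k. f (x (k + N))) \<longlonglongrightarrow> l"
    using K xS by (metis incseq_convergent)
  then have l: "(\<lambda>k. f (x k)) \<longlonglongrightarrow> l"
    by (rule LIMSEQ_offset)
  have "(\<lambda>k. B * (f (x (Suc k)) - f (x k))) \<longlonglongrightarrow> B * (l - l)"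
    by (intro tendsto_intros LIMSEQ_Suc l)
  then have upper: "(\<lambda>k. B * (f (x (Suc k)) - f (x k))) \<longlonglongrightarrow> 0"
    by simp
  have "(\<lambda>k. (norm (x (Suc k) - x k))\<^sup>2) \<longlonglongrightarrow> 0"
  proof (rule tendsto_sandwich[OF _ _ tendsto_const upper])
    show "\<forall>\<^sub>F k in sequentially. (norm (x (Suc k) - x k))\<^sup>2 \<le> B * (f (x (Suc k)) - f (x k))"
      unfolding eventually_sequentially using sq by blast
  qed simp
  then have "(\<lambda>k. sqrt ((norm (x (Suc k) - x k))\<^sup>2)) \<longlonglongrightarrow> sqrt 0"
    by (rule tendsto_real_sqrt)
  then show ?thesis
    by (simp add: tendsto_norm_zero_iff)
qed

theorem theorem3p14:
  fixes f :: "'a::{real_inner,complete_space} \<Rightarrow> real"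
    and S :: "'a set"
    and \<eta> :: "nat \<Rightarrow> real"
    and x :: "nat \<Rightarrow> 'a"
  assumes "continuous_on UNIV f"
    and "convex_on UNIV f"
    and "compact S"
    and "convex S"
    and "projected_subgradient_ascent f S \<eta> x"
    and "limsup (\<lambda>k. ereal (\<eta> k)) < \<infinity>"
    and "liminf (\<lambda>k. ereal (\<eta> k)) > 0"
  shows "\<forall>a. accumulation_point x a \<longrightarrow> first_order_stationary f S a"
proof (intro allI impI)
  fix a assume "accumulation_point x a"
  then obtain r where r: "strict_mono r" and xr: "(\<lambda>j. x (r j)) \<longlonglongrightarrow> a"
    by (auto simp: accumulation_point_def comp_def)
  obtain g where xS: "\<And>k. x k \<in> S" and g: "\<And>k. g k \<in> subdifferential f (x k)"
    and step: "\<And>k. x (Suc k) = proj S (x k + \<eta> k *\<^sub>R g k)"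
    using assms(5) unfolding projected_subgradient_ascent_def by metis
  have aS: "a \<in> S"
    by (rule closed_sequentially[OF compact_imp_closed[OF assms(3)] _ xr]) (rule xS)
  obtain B where "limsup (\<lambda>k. ereal (\<eta> k)) < ereal B"
    using ereal_dense2[OF assms(6)] by blast
  from Limsup_lessD[OF this] have evB: "\<forall>\<^sub>F k in sequentially. \<eta> k < B"
    by simp
  obtain c where "0 < ereal c" and cl: "ereal c < liminf (\<lambda>k. ereal (\<eta> k))"
    using ereal_dense2[OF assms(7)] by blast
  then have c: "0 < c"
    by simp
  from less_LiminfD[OF cl] have evc: "\<forall>\<^sub>F k in sequentially. c < \<eta> k"
    by simp
  obtain N where N: "\<And>k. N \<le> k \<Longrightarrow> c < \<eta> k \<and> \<eta> k < B"
    using eventually_conj[OF evc evB] by (auto simp: eventually_sequentially)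
  have \<Delta>0: "(\<lambda>k. x (Suc k) - x k) \<longlonglongrightarrow> 0"
  proof (rule projected_ascent_increments_tendsto_0[where x = x and g = g and \<eta> = \<eta>,
        OF _ assms(3,4) xS g step])
    show "continuous_on S f"
      using assms(1) continuous_on_subset by blast
    show "0 < \<eta> k \<and> \<eta> k \<le> B" if "N \<le> k" for k
      using N[OF that] c by linarith
  qed
  have \<Delta>r: "(\<lambda>j. x (Suc (r j)) - x (r j)) \<longlonglongrightarrow> 0"
    using LIMSEQ_subseq_LIMSEQ[OF \<Delta>0 r] by (simp add: comp_def)
  have xSr: "(\<lambda>j. x (Suc (r j))) \<longlonglongrightarrow> a"
    using tendsto_add[OF \<Delta>r xr] by simp
  have cont: "isCont f a"
    using assms(1) by (simp add: continuous_on_eq_continuous_at)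
  obtain M where M: "0 \<le> M" and evM: "\<forall>\<^sub>F j in sequentially. norm (g (r j)) \<le> M"
    using subgradients_bounded_at_limit[where h = "\<lambda>j. g (r j)", OF cont xr g] .
  define D where "D = diameter S"
  \<comment> \<open>The first two summands bound the stationarity error when the base point moves
    from \<open>x (Suc (r j))\<close> to \<open>a\<close>; the bracket bounds the error in the
    subgradient inequality when it moves from \<open>x (r j)\<close> to \<open>a\<close>. Both
    groups are nonnegative, so \<open>E j < \<epsilon>\<close> controls each of them.\<close>
  define E where "E j = norm (x (Suc (r j)) - x (r j)) * D / c + M * norm (x (Suc (r j)) - a) +
      (\<bar>f a - f (x (r j))\<bar> + M * norm (x (r j) - a))" for j
  have "E \<longlonglongrightarrow> norm (0::'a) * D / c + M * norm (a - a) + (\<bar>f a - f a\<bar> + M * norm (a - a))"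
    unfolding E_def using c
    by (intro tendsto_intros \<Delta>r xSr xr isCont_tendsto_compose[OF cont xr]) auto
  then have E0: "E \<longlonglongrightarrow> 0"
    by simp
  have D: "norm (z - w) \<le> D" if "z \<in> S" "w \<in> S" for z w
    using diameter_bounded_bound[OF compact_imp_bounded[OF assms(3)] that]
    by (simp add: D_def dist_norm)
  \<comment> \<open>Cauchy-Schwarz in the variational inequality, divided by the step size.
    Replacing \<open>\<eta> k\<close> by its lower bound \<open>c\<close> needs a nonnegative inner
    product; otherwise the claim holds because its right-hand side is nonnegative.\<close>
  have stat: "g k \<bullet> (z - x (Suc k)) \<le> norm (x (Suc k) - x k) * D / c"
    if "N \<le> k" "z \<in> S" for k z
  proof (cases "0 \<le> g k \<bullet> (z - x (Suc k))")
    case True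
    have "(x k + \<eta> k *\<^sub>R g k - x (Suc k)) \<bullet> (z - x (Suc k)) \<le> 0"
      using proj_dot[OF assms(3,4) that(2)] step by metis
    then have "\<eta> k * (g k \<bullet> (z - x (Suc k))) \<le> (x (Suc k) - x k) \<bullet> (z - x (Suc k))"
      by (simp add: algebra_simps)
    moreover have "c * (g k \<bullet> (z - x (Suc k))) \<le> \<eta> k * (g k \<bullet> (z - x (Suc k)))"
      using True N[OF that(1)] by (intro mult_right_mono) auto
    moreover have "(x (Suc k) - x k) \<bullet> (z - x (Suc k)) \<le> norm (x (Suc k) - x k) * norm (z - x (Suc k))"
      by (rule norm_cauchy_schwarz)
    moreover have "\<dots> \<le> norm (x (Suc k) - x k) * D"
      using D that(2) xS by (intro mult_left_mono) auto
    ultimately have "c * (g k \<bullet> (z - x (Suc k))) \<le> norm (x (Suc k) - x k) * D"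
      by linarith
    then show ?thesis
      using c by (simp add: pos_le_divide_eq mult.commute)
  next
    case False
    \<comment> \<open>Instantiating \<open>D\<close> with the same point \<open>x 0\<close> twice
      gives \<open>0 \<le> D\<close>.\<close>
    moreover have "0 \<le> norm (x (Suc k) - x k) * D / c"
      using c D[OF xS xS, of 0 0] by simp
    ultimately show ?thesis
      by linarith
  qed
  show "first_order_stationary f S a"
  proof (rule first_order_stationaryI_approximate[OF aS, of M])
    fix \<epsilon> :: real assume "0 < \<epsilon>"
    then have "\<forall>\<^sub>F j in sequentially. E j < \<epsilon>"
      by (rule order_tendstoD(2)[OF E0])
    moreover have "\<forall>\<^sub>F j in sequentially. N \<le> r j"
      using filterlim_subseq[OF r] by (simp add: filterlim_at_top)
    ultimately have "\<forall>\<^sub>F j in sequentially. norm (g (r j)) \<le> M \<and> E j < \<epsilon> \<and> N \<le> r j"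
      using evM by eventually_elim auto
    then obtain j where gM: "norm (g (r j)) \<le> M" and E: "E j < \<epsilon>" and Nj: "N \<le> r j"
      using eventually_happens'[OF sequentially_bot] by blast
    have dot: "g (r j) \<bullet> w \<le> M * norm w" for w
      using norm_cauchy_schwarz[of "g (r j)" w] mult_right_mono[OF gM, of "norm w"] by simp
    have E1: "0 \<le> norm (x (Suc (r j)) - x (r j)) * D / c + M * norm (x (Suc (r j)) - a)"
      using c M D[OF xS xS, of 0 0] by simp
    have E2: "0 \<le> \<bar>f a - f (x (r j))\<bar> + M * norm (x (r j) - a)"
      using M by simp
    have "g (r j) \<bullet> (y - a) \<le> f y - f a + \<epsilon>" for y
    proof -
      have "g (r j) \<bullet> (y - a) = g (r j) \<bullet> (y - x (r j)) + g (r j) \<bullet> (x (r j) - a)"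
        by (simp add: inner_diff_right)
      moreover have "f (x (r j)) + g (r j) \<bullet> (y - x (r j)) \<le> f y"
        using g[of "r j"] by (simp add: subdifferential_def)
      ultimately show ?thesis
        using dot[of "x (r j) - a"] E E1 unfolding E_def by linarith
    qed
    moreover have "g (r j) \<bullet> (z - a) \<le> \<epsilon>" if "z \<in> S" for z
    proof -
      have "g (r j) \<bullet> (z - a) = g (r j) \<bullet> (z - x (Suc (r j))) + g (r j) \<bullet> (x (Suc (r j)) - a)"
        by (simp add: inner_diff_right)
      then show ?thesis
        using stat[OF Nj that] dot[of "x (Suc (r j)) - a"] E E2 unfolding E_def by linarith
    qed
    ultimately show "\<exists>h. norm h \<le> M \<and> (\<forall>y. h \<bullet> (y - a) \<le> f y - f a + \<epsilon>) \<and>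
                         (\<forall>z\<in>S. h \<bullet> (z - a) \<le> \<epsilon>)"
      using gM by blast
  qed
qed

end
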